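(* Let $E$ be a real or complex Banach space and let $\mathcal{T} = (T_t)_{t \in J}$ be a semigroup on $E$ which is locally bounded at $0$, where either $J = \mathbb{N}$ or $J = (0,\infty)$. Let $\mathcal{U}$ be a free ultrafilter on $\mathbb{N}$ and let $P$ be a bounded linear operator on $E$. Then the following assertions are equivalent: (i) $(T_t)$ converges to $P$ with respect to the operator norm as $t\to\infty$. (ii) $(T_t^{\mathcal{U}})$ converges to $P^{\mathcal{U}}$ with respect to the operator norm as $t\to\infty$. (iii) $(T_t^{\mathcal{U}})$ converges strongly to $P^{\mathcal{U}}$ as $t\to\infty$.
   Context: $\mathbb{N} = \{1,2,\dots\}$. A semigroup on $E$ is a family $(T_t)_{t \in J}$ of bounded linear operators on $E$ with $T_{t+s} = T_tT_s$ for all $s,t \in J$; no continuity in $t$ is assumed. It is locally bounded at $0$ if for one (equivalently, all) $c \in J$ one has $\sup_{t \in (0,c]\cap J}\|T_t\| < \infty$ (automatic if $J=\mathbb{N}$). Ultra power: $E^{\mathcal{U}} := \ell^\infty(\mathbb{N};E)/c_{0,\mathcal{U}}(\mathbb{N};E)$, where $c_{0,\mathcal{U}}(\mathbb{N};E) = \{(f_n) \in \ell^\infty(\mathbb{N};E) : \lim_{\mathcal{U}} f_n = 0\}$. The class of $(f_n)$ is denoted $(f_n)^{\mathcal{U}}$, and $\|(f_n)^{\mathcal{U}}\| = \lim_{\mathcal{U}}\|f_n\|$. For a bounded linear operator $T$ on $E$, its lifting $T^{\mathcal{U}}$ on $E^{\mathcal{U}}$ is given by $T^{\mathcal{U}}(f_n)^{\mathcal{U}}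 = (Tf_n)^{\mathcal{U}}$. Strong convergence means convergence in the strong operator topology. *)

theory Defs
  imports "HOL-Analysis.Analysis"
begin

text \<open>
  A normed space over a scalar field \<open>'k\<close>.  By the Gelfand-Mazur theorem the real and the complex
  numbers are, up to isometric isomorphism, the only instances of \<^class>\<open>real_normed_field\<close>, so
  that this covers exactly the real and the complex normed spaces.  The second assumption says that
  the real normed structure of the type is the one obtained by restricting the scalars.
\<close>
locale normed_space_over = vector_space scale
  for scale :: "'k::real_normed_field \<Rightarrow> 'e::real_normed_vector \<Rightarrow> 'e" +
  assumes norm_scale: "norm (scale c x) = norm c * norm x"
    and scale_of_real: "scale (of_real r) x = r *\<^sub>R x"

text \<open>Only the restriction of \<open>T\<close> to the index set \<open>J\<close> matters.\<close>
definition operator_semigroup :: "real set \<Rightarrow> (real \<Rightarrow> 'e \<Rightarrow>\<^sub>L 'e::real_normed_vector) \<Rightarrow> bool" where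
  "operator_semigroup J T \<longleftrightarrow> (\<forall>s\<in>J. \<forall>t\<in>J. T (t + s) = T t o\<^sub>L T s)"

definition locally_bounded_at_0 :: "real set \<Rightarrow> (real \<Rightarrow> 'e \<Rightarrow>\<^sub>L 'e::real_normed_vector) \<Rightarrow> bool" where
  "locally_bounded_at_0 J T \<longleftrightarrow> (\<exists>c\<in>J. bdd_above ((\<lambda>t. norm (T t)) ` ({0<..c} \<inter> J)))"

definition at_infinity_in :: "real set \<Rightarrow> real filter" where
  "at_infinity_in J = inf at_top (principal J)"

definition free_ultrafilter :: "'i filter \<Rightarrow> bool" where
  "free_ultrafilter U \<longleftrightarrow> U \<noteq> bot
     \<and> (\<forall>A. eventually (\<lambda>i. i \<in> A) U \<or> eventually (\<lambda>i. i \<notin> A) U)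
     \<and> (\<forall>i. eventually (\<lambda>j. j \<noteq> i) U)"

text \<open>
  The ultra power of \<open>'e\<close> depends on the filter \<open>U\<close> and hence is not a type: it is the set of cosets
  of \<open>c0_along U\<close> in the space of bounded sequences.  As the topology of \<^typ>\<open>nat\<close> is discrete,
  the latter is the type \<open>nat \<Rightarrow>\<^sub>C 'e\<close> of bounded continuous functions.
\<close>
definition c0_along :: "nat filter \<Rightarrow> (nat \<Rightarrow>\<^sub>C 'e::real_normed_vector) set" where
  "c0_along U = {f. (apply_bcontfun f \<longlongrightarrow> 0) U}"

definition ultra_class :: "nat filter \<Rightarrow> (nat \<Rightarrow>\<^sub>C 'e::real_normed_vector) \<Rightarrow> (nat \<Rightarrow>\<^sub>C 'e) set" where
  "ultra_class U f = {g. g - f \<in> c0_along U}"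

definition ultra_power :: "nat filter \<Rightarrow> (nat \<Rightarrow>\<^sub>C 'e::real_normed_vector) set set" where
  "ultra_power U = range (ultra_class U)"

text \<open>
  The operations on classes are defined through representatives; the lemmas below show that they do
  not depend on the choice of the latter.
\<close>
definition ultra_diff :: "nat filter \<Rightarrow> (nat \<Rightarrow>\<^sub>C 'e::real_normed_vector) set \<Rightarrow> (nat \<Rightarrow>\<^sub>C 'e) set
    \<Rightarrow> (nat \<Rightarrow>\<^sub>C 'e) set" where
  "ultra_diff U X Y = (\<Union>f\<in>X. \<Union>g\<in>Y. ultra_class U (f - g))"

definition ultra_norm :: "nat filter \<Rightarrow> (nat \<Rightarrow>\<^sub>C 'e::real_normed_vector) set \<Rightarrow> real" where
  "ultra_norm U X = (THE c. \<forall>f\<in>X. ((\<lambda>n. norm (apply_bcontfun f n)) \<longlongrightarrow> c) U)"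

definition bcontfun_map :: "('e::real_normed_vector \<Rightarrow>\<^sub>L 'e) \<Rightarrow> (nat \<Rightarrow>\<^sub>C 'e) \<Rightarrow> (nat \<Rightarrow>\<^sub>C 'e)" where
  "bcontfun_map T f = Bcontfun (\<lambda>n. blinfun_apply T (apply_bcontfun f n))"

definition ultra_lift :: "nat filter \<Rightarrow> ('e::real_normed_vector \<Rightarrow>\<^sub>L 'e) \<Rightarrow> (nat \<Rightarrow>\<^sub>C 'e) set
    \<Rightarrow> (nat \<Rightarrow>\<^sub>C 'e) set" where
  "ultra_lift U T X = (\<Union>f\<in>X. ultra_class U (bcontfun_map T f))"

text \<open>
  The operator norm of an operator on the ultra power, meaningful only for bounded operators (as the
  supremum of an unbounded set of reals is unspecified); differences of lifted operators are bounded.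
\<close>
definition ultra_onorm :: "nat filter \<Rightarrow> ((nat \<Rightarrow>\<^sub>C 'e::real_normed_vector) set \<Rightarrow> (nat \<Rightarrow>\<^sub>C 'e) set)
    \<Rightarrow> real" where
  "ultra_onorm U S = (SUP X\<in>{X \<in> ultra_power U. ultra_norm U X \<le> 1}. ultra_norm U (S X))"

definition ultra_norm_convergent :: "nat filter
    \<Rightarrow> ('t \<Rightarrow> (nat \<Rightarrow>\<^sub>C 'e::real_normed_vector) set \<Rightarrow> (nat \<Rightarrow>\<^sub>C 'e) set)
    \<Rightarrow> ((nat \<Rightarrow>\<^sub>C 'e) set \<Rightarrow> (nat \<Rightarrow>\<^sub>C 'e) set) \<Rightarrow> 't filter \<Rightarrow> bool" where
  "ultra_norm_convergent U S R F \<longleftrightarrow>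
     ((\<lambda>t. ultra_onorm U (\<lambda>X. ultra_diff U (S t X) (R X))) \<longlongrightarrow> 0) F"

definition ultra_strongly_convergent :: "nat filter
    \<Rightarrow> ('t \<Rightarrow> (nat \<Rightarrow>\<^sub>C 'e::real_normed_vector) set \<Rightarrow> (nat \<Rightarrow>\<^sub>C 'e) set)
    \<Rightarrow> ((nat \<Rightarrow>\<^sub>C 'e) set \<Rightarrow> (nat \<Rightarrow>\<^sub>C 'e) set) \<Rightarrow> 't filter \<Rightarrow> bool" where
  "ultra_strongly_convergent U S R F \<longleftrightarrow>
     (\<forall>X\<in>ultra_power U. ((\<lambda>t. ultra_norm U (ultra_diff U (S t X) (R X))) \<longlongrightarrow> 0) F)"

lemma apply_bcontfun_map:
  "apply_bcontfun (bcontfun_map T f) = (\<lambda>n. blinfun_apply T (apply_bcontfun f n))"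
proof -
  have "bounded (blinfun_apply T ` range (apply_bcontfun f))"
    by (rule bounded_linear_image) (auto intro: blinfun.bounded_linear_right)
  then have "(\<lambda>n. blinfun_apply T (apply_bcontfun f n)) \<in> bcontfun"
    by (simp add: bcontfun_def image_image)
  then show ?thesis
    by (simp add: bcontfun_map_def Bcontfun_inverse)
qed

lemma mem_ultra_class_iff:
  "g \<in> ultra_class U f \<longleftrightarrow> ((\<lambda>n. apply_bcontfun g n - apply_bcontfun f n) \<longlongrightarrow> 0) U"
  by (simp add: ultra_class_def c0_along_def minus_bcontfun.rep_eq)

lemma ultra_class_refl: "f \<in> ultra_class U f"
  by (simp add: mem_ultra_class_iff)

lemma ultra_class_nonempty: "ultra_class U f \<noteq> {}"
  using ultra_class_refl by blast

lemma ultra_class_eqI: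
  assumes "g \<in> ultra_class U f"
  shows "ultra_class U g = ultra_class U f"
proof -
  have *: "((\<lambda>n. apply_bcontfun g n - apply_bcontfun f n) \<longlongrightarrow> 0) U"
    using assms by (simp add: mem_ultra_class_iff)
  have "h \<in> ultra_class U g \<longleftrightarrow> h \<in> ultra_class U f" for h
  proof
    assume "h \<in> ultra_class U g"
    from tendsto_add[OF this[unfolded mem_ultra_class_iff] *] show "h \<in> ultra_class U f"
      by (simp add: mem_ultra_class_iff)
  next
    assume "h \<in> ultra_class U f"
    from tendsto_diff[OF this[unfolded mem_ultra_class_iff] *] show "h \<in> ultra_class U g"
      by (simp add: mem_ultra_class_iff)
  qed
  then show ?thesis by blast
qed

lemma ultra_diff_class:
  "ultra_diff U (ultra_class U f) (ultra_class U g) = ultra_class U (f - g)"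
proof -
  have "ultra_class U (f' - g') = ultra_class U (f - g)"
    if f': "f' \<in> ultra_class U f" and g': "g' \<in> ultra_class U g" for f' g'
  proof (rule ultra_class_eqI)
    show "f' - g' \<in> ultra_class U (f - g)"
      using tendsto_diff[OF f'[unfolded mem_ultra_class_iff] g'[unfolded mem_ultra_class_iff]]
      by (simp add: mem_ultra_class_iff minus_bcontfun.rep_eq algebra_simps)
  qed
  then have "ultra_diff U (ultra_class U f) (ultra_class U g)
      = (\<Union>f'\<in>ultra_class U f. \<Union>g'\<in>ultra_class U g. ultra_class U (f - g))"
    unfolding ultra_diff_def by (intro SUP_cong refl)
  then show ?thesis
    by (simp add: ultra_class_nonempty)
qed

lemma ultra_lift_class:
  "ultra_lift U T (ultra_class U f) = ultra_class U (bcontfun_map T f)"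
proof -
  have "ultra_class U (bcontfun_map T g) = ultra_class U (bcontfun_map T f)"
    if g: "g \<in> ultra_class U f" for g
  proof (rule ultra_class_eqI)
    show "bcontfun_map T g \<in> ultra_class U (bcontfun_map T f)"
      using blinfun.tendsto[OF tendsto_const[of T] g[unfolded mem_ultra_class_iff]]
      by (simp add: mem_ultra_class_iff apply_bcontfun_map blinfun.diff_right)
  qed
  then have "ultra_lift U T (ultra_class U f)
      = (\<Union>g\<in>ultra_class U f. ultra_class U (bcontfun_map T f))"
    unfolding ultra_lift_def by (intro SUP_cong refl)
  then show ?thesis
    by (simp add: ultra_class_nonempty)
qed

lemma free_ultrafilter_bounded_convergent:
  fixes h :: "nat \<Rightarrow> real"
  assumes U: "free_ultrafilter U" and h: "bounded (range h)"
  shows "\<exists>c. (h \<longlongrightarrow> c) U"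
proof -
  have "compact (closure (range h))"
    using h by (simp add: compact_closure)
  moreover have "filtermap h U \<noteq> bot"
    using U by (simp add: free_ultrafilter_def filtermap_bot_iff)
  moreover have "eventually (\<lambda>x. x \<in> closure (range h)) (filtermap h U)"
    by (simp add: eventually_filtermap closure_subset[THEN subsetD])
  ultimately obtain c where c: "inf (nhds c) (filtermap h U) \<noteq> bot"
    unfolding compact_filter by blast
  have "(h \<longlongrightarrow> c) U"
  proof (rule topological_tendstoI)
    fix S assume S: "open S" "c \<in> S"
    show "eventually (\<lambda>n. h n \<in> S) U"
    proof (rule ccontr)
      assume "\<not> eventually (\<lambda>n. h n \<in> S) U"
      moreover have "eventually (\<lambda>n. n \<in> h -` S) U \<or> eventually (\<lambda>n. n \<notin> h -` S) U"
        using U unfolding free_ultrafilter_def by blast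
      ultimately have "eventually (\<lambda>x. x \<notin> S) (filtermap h U)"
        by (simp add: eventually_filtermap)
      moreover have "eventually (\<lambda>x. x \<in> S) (nhds c)"
        using S by (simp add: eventually_nhds_in_open)
      ultimately have "eventually (\<lambda>_. False) (inf (nhds c) (filtermap h U))"
        unfolding eventually_inf by (intro exI[of _ "\<lambda>x. x \<in> S"] exI[of _ "\<lambda>x. x \<notin> S"]) auto
      with c show False
        by (simp add: trivial_limit_def)
    qed
  qed
  then show ?thesis ..
qed

lemma ultra_norm_class_tendsto:
  assumes U: "free_ultrafilter U"
  shows "((\<lambda>n. norm (apply_bcontfun f n)) \<longlongrightarrow> ultra_norm U (ultra_class U f)) U"
proof -
  have nt: "U \<noteq> bot"
    using U by (simp add: free_ultrafilter_def)
  have "bounded (range (\<lambda>n. norm (apply_bcontfun f n)))"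
    using bounded_apply_bcontfun[of f] by (auto simp: bounded_iff)
  then obtain c where c: "((\<lambda>n. norm (apply_bcontfun f n)) \<longlongrightarrow> c) U"
    using free_ultrafilter_bounded_convergent[OF U] by blast
  have all: "((\<lambda>n. norm (apply_bcontfun g n)) \<longlongrightarrow> c) U" if "g \<in> ultra_class U f" for g
  proof -
    have "((\<lambda>n. norm (apply_bcontfun g n) - norm (apply_bcontfun f n)) \<longlongrightarrow> 0) U"
      by (rule Lim_null_comparison[OF _ tendsto_norm_zero[OF that[unfolded mem_ultra_class_iff]]])
        (simp add: norm_triangle_ineq3 always_eventually)
    from tendsto_add[OF this c] show ?thesis by simp
  qed
  have "ultra_norm U (ultra_class U f) = c"
    unfolding ultra_norm_def
    by (rule the_equality) (use all in blast, use tendsto_unique[OF nt _ c] ultra_class_refl in blast)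
  with c show ?thesis by simp
qed

lemma ultra_norm_class:
  assumes "free_ultrafilter U"
  shows "ultra_norm U (ultra_class U f) = Lim U (\<lambda>n. norm (apply_bcontfun f n))"
proof -
  have "U \<noteq> bot"
    using assms by (simp add: free_ultrafilter_def)
  from tendsto_Lim[OF this ultra_norm_class_tendsto[OF assms]] show ?thesis ..
qed

end

theory Submission
  imports Defs
begin

text \<open>
  Lifting an operator to the ultra power preserves its norm: constant sequences embed the space
  isometrically into the ultra power, and the lifting of \<open>D\<close> is bounded by \<open>norm D\<close> because it
  acts coordinatewise.  As \<open>T\<^sub>t\<^sup>U - P\<^sup>U\<close> is the lifting of \<open>T\<^sub>t - P\<close>, norm convergence on the
  space and on the ultra power are the same (\<open>ultra_norm_convergent_lift_iff\<close>), and either one implies strong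
  convergence on the ultra power.

  The substance is that strong convergence on the ultra power implies norm convergence
  (\<open>ultra_strong_imp_norm_convergent\<close>).  Looking at constant sequences shows that \<open>T\<^sub>t\<close> converges
  strongly to \<open>P\<close>, and the semigroup law then gives \<open>P T\<^sub>s = T\<^sub>s P = P = P\<^sup>2\<close>.  Hence
  \<open>(T\<^sub>t - P) (T\<^sub>s - P) = T\<^sub>t\<^sub>+\<^sub>s - P\<close>: the differences form a semigroup themselves, and the
  question becomes whether a semigroup whose liftings tend strongly to \<open>0\<close> tends to \<open>0\<close> in norm.

  In discrete time this is answered by contraposition (\<open>ultra_strong_limit_zero_imp_norm\<close>).  If \<open>B\<^sub>n\<close> is a
  semigroup that does not tend to \<open>0\<close> in norm, then for every \<open>N\<close> there is a time \<open>n\<close> such that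
  \<open>norm B\<^sub>n\<close> exceeds half of each of the \<open>N\<close> norms before it, since otherwise the norms would
  decay geometrically (\<open>halving_tendsto_zero\<close>).  A unit vector \<open>x\<^sub>N\<close> on which \<open>B\<^sub>n\<close> nearly attains
  its norm then satisfies \<open>norm (B\<^sub>m x\<^sub>N) > 1/4\<close> for \<open>1 \<le> m \<le> N\<close>, because
  \<open>B\<^sub>n x\<^sub>N = B\<^sub>n\<^sub>-\<^sub>m (B\<^sub>m x\<^sub>N)\<close> (\<open>non_vanishing_semigroup_orbit\<close>).  The class of
  \<open>(x\<^sub>N)\<close> is a single element of the ultra power whose whole orbit stays at norm at least \<open>1/4\<close>.

  The discrete result is applied to the multiples of a time \<open>c\<close> such that \<open>T\<close> is bounded on
  \<open>(0, c]\<close>.  Writing \<open>t = n c + r\<close> with \<open>0 < r \<le> c\<close> gives \<open>T\<^sub>t - P = (T\<^sub>n\<^sub>c - P) T\<^sub>r\<close>, so that the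
  bound on \<open>T\<^sub>r\<close> carries the convergence over to all times
  (\<open>semigroup_norm_limit_from_multiples\<close>).
\<close>

section \<open>Halving sequences\<close>

text \<open>
  If every term beyond \<open>N\<close> is at most half of one of the \<open>N\<close> terms before it, then following
  such predecessors down to the initial segment halves the value at least once for every \<open>N\<close>
  steps, so the decay is geometric.
\<close>

lemma halving_tendsto_zero:
  fixes a :: "nat \<Rightarrow> real"
  assumes nonneg: "\<And>n. 0 \<le> a n"
    and half: "\<And>n. N < n \<Longrightarrow> \<exists>m\<in>{1..N}. a n \<le> a (n - m) / 2"
  shows "a \<longlonglongrightarrow> 0"
proof -
  define b where "b = Max (a ` {..N})"
  have b: "a n \<le> b" if "n \<le> N" for n
    unfolding b_def using that by (intro Max_ge) auto
  have b0: "0 \<le> b"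
    using nonneg[of 0] b[of 0] by simp
  have decay: "a n \<le> b / 2 ^ k" if "k * N < n \<or> k = 0" for n k
    using that
  proof (induction n arbitrary: k rule: less_induct)
    case (less n)
    show ?case
    proof (cases "n \<le> N")
      case True
      then have "k = 0"
        using less.prems by (cases k) auto
      then show ?thesis using b[OF True] by simp
    next
      case False
      then obtain m where m: "m \<in> {1..N}" and am: "a n \<le> a (n - m) / 2"
        using half[of n] by auto
      have lt: "n - m < n"
        using m False by auto
      have k: "(k - 1) * N < n - m \<or> k - 1 = 0"
        using less.prems m by (cases k) auto
      note am
      also have "a (n - m) / 2 \<le> b / 2 ^ (k - 1) / 2"
        using less.IH[OF lt k] by (rule divide_right_mono) simp
      also have "\<dots> \<le> b / 2 ^ k"
        using b0 by (cases k) auto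
      finally show ?thesis .
    qed
  qed
  show ?thesis
  proof (rule LIMSEQ_I)
    fix e :: real assume "0 < e"
    have "(\<lambda>k. b * (1 / 2) ^ k) \<longlonglongrightarrow> b * 0"
      by (intro tendsto_intros LIMSEQ_power_zero) simp
    then have "\<forall>\<^sub>F k in sequentially. b * (1 / 2) ^ k < e"
      using \<open>0 < e\<close> by (auto dest: order_tendstoD(2))
    then obtain k where "b * (1 / 2) ^ k < e"
      by (auto simp: eventually_sequentially)
    then have k: "b / 2 ^ k < e"
      by (simp add: power_divide)
    have "norm (a n - 0) < e" if "Suc (k * N) \<le> n" for n
      using decay[of k n] that k nonneg[of n] by simp
    then show "\<exists>no. \<forall>n\<ge>no. norm (a n - 0) < e" by blast
  qed
qed

section \<open>Vectors with long non-small orbits\<close>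

lemma blinfun_half_norm_attained:
  fixes A :: "'a::real_normed_vector \<Rightarrow>\<^sub>L 'b::real_normed_vector"
  assumes "A \<noteq> 0"
  obtains x where "norm x = 1" "norm A / 2 < norm (blinfun_apply A x)"
proof -
  have "\<exists>y. norm A / 2 * norm y < norm (blinfun_apply A y)"
  proof (rule ccontr)
    assume "\<not> ?thesis"
    then have "norm A \<le> norm A / 2"
      by (intro norm_blinfun_bound) (auto simp: not_less)
    with assms show False by simp
  qed
  then obtain y where y: "norm A / 2 * norm y < norm (blinfun_apply A y)" ..
  then have "y \<noteq> 0" by auto
  show ?thesis
  proof
    show "norm (y /\<^sub>R norm y) = 1" using \<open>y \<noteq> 0\<close> by simp
    show "norm A / 2 < norm (blinfun_apply A (y /\<^sub>R norm y))"
      using y \<open>y \<noteq> 0\<close> by (simp add: blinfun.scaleR_right field_simps)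
  qed
qed

text \<open>
  The vector is chosen for its behaviour at one late time \<open>n\<close> with a comparatively large
  \<open>norm (B n)\<close>: if \<open>B m\<close> made it small at some earlier time \<open>m\<close>, then \<open>B (n - m)\<close>, whose norm is
  less than \<open>2 * norm (B n)\<close>, could not bring it back to size \<open>norm (B n) / 2\<close>.  It matters that
  the constant \<open>1 / 4\<close> is independent of \<open>N\<close>, as the vectors for all \<open>N\<close> are later combined into
  one element of the ultra power.
\<close>

lemma non_vanishing_semigroup_orbit:
  fixes B :: "nat \<Rightarrow> 'e::real_normed_vector \<Rightarrow>\<^sub>L 'e"
  assumes semigroup: "\<And>m n. 1 \<le> m \<Longrightarrow> 1 \<le> n \<Longrightarrow> B (m + n) = B m o\<^sub>L B n"
    and nonzero: "\<not> B \<longlonglongrightarrow> 0"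
  obtains x where "norm x = 1" "\<And>m. m \<in> {1..N} \<Longrightarrow> 1 / 4 < norm (blinfun_apply (B m) x)"
proof -
  \<comment> \<open>\<open>Suc N\<close> instead of \<open>N\<close> keeps the window nonempty, which makes \<open>B n\<close> nonzero.\<close>
  have "\<exists>n>Suc N. \<forall>m\<in>{1..Suc N}. norm (B (n - m)) / 2 < norm (B n)"
  proof (rule ccontr)
    assume no: "\<not> ?thesis"
    have "(\<lambda>n. norm (B n)) \<longlonglongrightarrow> 0"
    proof (rule halving_tendsto_zero)
      show "\<exists>m\<in>{1..Suc N}. norm (B n) \<le> norm (B (n - m)) / 2" if "Suc N < n" for n
        using no that by (meson not_less)
    qed simp
    with nonzero show False by (simp add: tendsto_norm_zero_iff)
  qed
  then obtain n where n: "Suc N < n"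
    and late: "\<And>m. m \<in> {1..Suc N} \<Longrightarrow> norm (B (n - m)) / 2 < norm (B n)"
    by blast
  have "0 \<le> norm (B (n - 1)) / 2" by simp
  also have "\<dots> < norm (B n)" by (rule late) simp
  finally have "0 < norm (B n)" .
  then obtain x where x: "norm x = 1" "norm (B n) / 2 < norm (blinfun_apply (B n) x)"
    using blinfun_half_norm_attained[of "B n"] zero_less_norm_iff by metis
  have "1 / 4 < norm (blinfun_apply (B m) x)" if m: "m \<in> {1..N}" for m
  proof -
    have "1 \<le> n - m" "1 \<le> m" "n - m + m = n"
      using m n by auto
    with semigroup[of "n - m" m] have "B n = B (n - m) o\<^sub>L B m"
      by simp
    then have "norm (blinfun_apply (B n) x) \<le> norm (B (n - m)) * norm (blinfun_apply (B m) x)"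
      by (simp add: norm_blinfun)
    also have "\<dots> \<le> (2 * norm (B n)) * norm (blinfun_apply (B m) x)"
      using late[of m] m by (intro mult_right_mono) auto
    finally have "norm (B n) / 2 < norm (B n) * (2 * norm (blinfun_apply (B m) x))"
      using x by simp
    then show ?thesis
      using \<open>0 < norm (B n)\<close> by (simp add: field_simps)
  qed
  with x(1) show ?thesis by (rule that)
qed

section \<open>Lifted operators on the ultra power\<close>

lemma ultra_diff_lift:
  assumes "X \<in> ultra_power U"
  shows "ultra_diff U (ultra_lift U A X) (ultra_lift U B X) = ultra_lift U (A - B) X"
proof -
  obtain f where X: "X = ultra_class U f"
    using assms by (auto simp: ultra_power_def)
  have "bcontfun_map A f - bcontfun_map B f = bcontfun_map (A - B) f"
    by (rule bcontfun_eqI) (simp add: apply_bcontfun_map blinfun.diff_left)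
  then show ?thesis
    by (simp add: X ultra_lift_class ultra_diff_class)
qed

lemma ultra_norm_const:
  assumes "free_ultrafilter U"
  shows "ultra_norm U (ultra_class U (const_bcontfun x)) = norm x"
proof -
  have "U \<noteq> bot"
    using assms by (simp add: free_ultrafilter_def)
  from tendsto_unique[OF this ultra_norm_class_tendsto[OF assms], of "const_bcontfun x" "norm x"]
  show ?thesis
    by (simp add: const_bcontfun.rep_eq)
qed

lemma bcontfun_map_const:
  "bcontfun_map A (const_bcontfun x) = const_bcontfun (blinfun_apply A x)"
  by (rule bcontfun_eqI) (simp add: apply_bcontfun_map const_bcontfun.rep_eq)

lemma ultra_norm_nonneg:
  assumes "free_ultrafilter U" "X \<in> ultra_power U"
  shows "0 \<le> ultra_norm U X"
proof -
  obtain f where X: "X = ultra_class U f"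
    using assms(2) by (auto simp: ultra_power_def)
  have "U \<noteq> bot"
    using assms(1) by (simp add: free_ultrafilter_def)
  then show ?thesis
    unfolding X by (rule tendsto_lowerbound[OF ultra_norm_class_tendsto[OF assms(1)], rotated]) simp
qed

lemma ultra_lift_in_ultra_power:
  assumes "X \<in> ultra_power U"
  shows "ultra_lift U A X \<in> ultra_power U"
  using assms by (auto simp: ultra_power_def ultra_lift_class)

lemma ultra_norm_lift_le:
  assumes U: "free_ultrafilter U" and X: "X \<in> ultra_power U"
  shows "ultra_norm U (ultra_lift U A X) \<le> norm A * ultra_norm U X"
proof -
  obtain f where f: "X = ultra_class U f"
    using X by (auto simp: ultra_power_def)
  have "U \<noteq> bot"
    using U by (simp add: free_ultrafilter_def)
  then show ?thesis
    unfolding f ultra_lift_class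
    by (rule tendsto_le[OF _ tendsto_mult_left[OF ultra_norm_class_tendsto[OF U]]
          ultra_norm_class_tendsto[OF U]])
      (simp add: apply_bcontfun_map norm_blinfun)
qed

text \<open>
  The lower bound comes from the constant sequences, which embed the space isometrically; the
  upper bound holds because lifted operators act coordinatewise.
\<close>

lemma ultra_onorm_lift:
  assumes U: "free_ultrafilter U"
  shows "ultra_onorm U (ultra_lift U A) = norm A"
proof (rule antisym)
  let ?B = "{X \<in> ultra_power U. ultra_norm U X \<le> 1}"
  have le: "ultra_norm U (ultra_lift U A X) \<le> norm A" if "X \<in> ?B" for X
    using ultra_norm_lift_le[OF U, of X A] that mult_left_le[of "ultra_norm U X" "norm A"] by auto
  have const: "ultra_class U (const_bcontfun x) \<in> ?B" if "norm x \<le> 1" for x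
    using that by (simp add: ultra_power_def ultra_norm_const[OF U])
  have "?B \<noteq> {}"
    using const[of 0] by auto
  then show "ultra_onorm U (ultra_lift U A) \<le> norm A"
    unfolding ultra_onorm_def using le by (rule cSUP_least)
  have unit: "norm (blinfun_apply A x) \<le> ultra_onorm U (ultra_lift U A)" if "norm x \<le> 1" for x
  proof -
    have "bdd_above ((\<lambda>X. ultra_norm U (ultra_lift U A X)) ` ?B)"
      using le by (rule bdd_aboveI2)
    from cSUP_upper[OF const[OF that] this] show ?thesis
      by (simp add: ultra_onorm_def ultra_lift_class bcontfun_map_const ultra_norm_const[OF U])
  qed
  show "norm A \<le> ultra_onorm U (ultra_lift U A)"
  proof (rule norm_blinfun_bound)
    show "0 \<le> ultra_onorm U (ultra_lift U A)"
      using unit[of 0] by simp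
    show "norm (blinfun_apply A x) \<le> ultra_onorm U (ultra_lift U A) * norm x" for x
      using unit[of "x /\<^sub>R norm x"]
      by (cases "x = 0") (simp_all add: blinfun.scaleR_right field_simps)
  qed
qed

lemma ultra_norm_convergent_lift_iff:
  assumes "free_ultrafilter U"
  shows "ultra_norm_convergent U (\<lambda>t. ultra_lift U (T t)) (ultra_lift U P) F \<longleftrightarrow> (T \<longlongrightarrow> P) F"
proof -
  have "ultra_onorm U (\<lambda>X. ultra_diff U (ultra_lift U (T t) X) (ultra_lift U P X)) = norm (T t - P)"
    for t
    unfolding ultra_onorm_lift[OF assms, symmetric] ultra_onorm_def
    by (rule SUP_cong) (auto simp: ultra_diff_lift)
  then show ?thesis
    by (simp add: ultra_norm_convergent_def Lim_null[of T] tendsto_norm_zero_iff)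
qed

lemma ultra_strongly_convergent_lift_iff:
  "ultra_strongly_convergent U (\<lambda>t. ultra_lift U (T t)) (ultra_lift U P) F \<longleftrightarrow>
    (\<forall>X\<in>ultra_power U. ((\<lambda>t. ultra_norm U (ultra_lift U (T t - P) X)) \<longlongrightarrow> 0) F)"
  by (simp add: ultra_strongly_convergent_def ultra_diff_lift cong: ball_cong)

lemma ultra_strongly_convergent_liftI:
  fixes T :: "'t \<Rightarrow> 'e::real_normed_vector \<Rightarrow>\<^sub>L 'e"
  assumes U: "free_ultrafilter U" and lim: "(T \<longlongrightarrow> P) F"
  shows "ultra_strongly_convergent U (\<lambda>t. ultra_lift U (T t)) (ultra_lift U P) F"
  unfolding ultra_strongly_convergent_lift_iff
proof
  fix X :: "(nat \<Rightarrow>\<^sub>C 'e) set" assume X: "X \<in> ultra_power U"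
  have "((\<lambda>t. norm (T t - P) * ultra_norm U X) \<longlongrightarrow> 0) F"
    using lim by (intro tendsto_mult_left_zero tendsto_norm_zero) (simp add: Lim_null[of T])
  then show "((\<lambda>t. ultra_norm U (ultra_lift U (T t - P) X)) \<longlongrightarrow> 0) F"
    by (rule Lim_null_comparison[rotated])
      (simp add: ultra_norm_lift_le[OF U X] ultra_norm_nonneg[OF U ultra_lift_in_ultra_power[OF X]])
qed

lemma ultra_strongly_convergent_pointwise:
  assumes U: "free_ultrafilter U"
    and conv: "ultra_strongly_convergent U (\<lambda>t. ultra_lift U (T t)) (ultra_lift U P) F"
  shows "((\<lambda>t. blinfun_apply (T t) x) \<longlongrightarrow> blinfun_apply P x) F"
proof -
  have "ultra_class U (const_bcontfun x) \<in> ultra_power U"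
    by (simp add: ultra_power_def)
  then have "((\<lambda>t. norm (blinfun_apply (T t - P) x)) \<longlongrightarrow> 0) F"
    using conv unfolding ultra_strongly_convergent_lift_iff
    by (auto simp: ultra_lift_class bcontfun_map_const ultra_norm_const[OF U])
  then show ?thesis
    by (simp add: tendsto_norm_zero_iff blinfun.diff_left Lim_null[of "\<lambda>t. blinfun_apply (T t) x"])
qed

text \<open>
  A vector \<open>x N\<close> whose orbit is not small up to time \<open>N\<close> exists for every \<open>N\<close>.  For a fixed time
  \<open>m\<close> all but finitely many of them satisfy \<open>norm (B m (x N)) > 1/4\<close>, and a free ultrafilter
  ignores finite sets; so the class of the sequence \<open>x\<close> has an orbit that does not approach \<open>0\<close>.
\<close>

lemma ultra_strong_limit_zero_imp_norm:
  fixes B :: "nat \<Rightarrow> 'e::real_normed_vector \<Rightarrow>\<^sub>L 'e"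
  assumes U: "free_ultrafilter U"
    and semigroup: "\<And>m n. 1 \<le> m \<Longrightarrow> 1 \<le> n \<Longrightarrow> B (m + n) = B m o\<^sub>L B n"
    and strong: "\<And>X. X \<in> ultra_power U \<Longrightarrow> (\<lambda>n. ultra_norm U (ultra_lift U (B n) X)) \<longlonglongrightarrow> 0"
  shows "B \<longlonglongrightarrow> 0"
proof (rule ccontr)
  assume "\<not> B \<longlonglongrightarrow> 0"
  then have "\<exists>x. norm x = 1 \<and> (\<forall>m\<in>{1..N}. 1 / 4 < norm (blinfun_apply (B m) x))" for N
    using non_vanishing_semigroup_orbit[of B N] semigroup by metis
  then obtain x where unit: "\<And>N. norm (x N) = 1"
    and large: "\<And>N m. m \<in> {1..N} \<Longrightarrow> 1 / 4 < norm (blinfun_apply (B m) (x N))"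
    by metis
  define f where "f = Bcontfun x"
  have "x \<in> bcontfun"
    using unit by (auto simp: bcontfun_def bounded_iff intro!: exI[of _ 1])
  then have f: "apply_bcontfun f = x"
    by (simp add: f_def Bcontfun_inverse)
  have nt: "U \<noteq> bot"
    using U by (simp add: free_ultrafilter_def)
  have lower: "1 / 4 \<le> ultra_norm U (ultra_lift U (B m) (ultra_class U f))" if "1 \<le> m" for m
  proof -
    have "\<forall>\<^sub>F N in U. N \<noteq> i" for i
      using U by (simp add: free_ultrafilter_def)
    then have "\<forall>\<^sub>F N in U. \<forall>i\<in>{..<m}. N \<noteq> i"
      by (intro eventually_ball_finite) auto
    then have "\<forall>\<^sub>F N in U. 1 / 4 \<le> norm (apply_bcontfun (bcontfun_map (B m) f) N)"
    proof (rule eventually_mono)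
      fix N assume "\<forall>i\<in>{..<m}. N \<noteq> i"
      then have "m \<in> {1..N}"
        using that by (auto simp: not_less[symmetric])
      then show "1 / 4 \<le> norm (apply_bcontfun (bcontfun_map (B m) f) N)"
        using large[of m N] by (simp add: apply_bcontfun_map f)
    qed
    from tendsto_lowerbound[OF ultra_norm_class_tendsto[OF U] this nt] show ?thesis
      by (simp add: ultra_lift_class)
  qed
  have "ultra_class U f \<in> ultra_power U"
    by (simp add: ultra_power_def)
  from strong[OF this] have "\<forall>\<^sub>F m in sequentially.
      ultra_norm U (ultra_lift U (B m) (ultra_class U f)) < 1 / 4"
    by (rule order_tendstoD) simp
  moreover have "\<forall>\<^sub>F m in sequentially. 1 \<le> (m::nat)"
    by (rule eventually_ge_at_top)
  ultimately have "\<forall>\<^sub>F m::nat in sequentially. False"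
    by eventually_elim (use lower in force)
  then show False by simp
qed

section \<open>Time sets\<close>

lemma filterlim_at_infinity_in:
  assumes "filterlim g at_top F" "\<forall>\<^sub>F x in F. g x \<in> J"
  shows "filterlim g (at_infinity_in J) F"
  using assms by (simp add: at_infinity_in_def filterlim_inf filterlim_principal)

lemma eventually_at_infinity_in: "\<forall>\<^sub>F t in at_infinity_in J. t \<in> J"
  by (simp add: at_infinity_in_def eventually_inf_principal)

lemma at_infinity_in_le: "at_infinity_in J \<le> at_top"
  by (simp add: at_infinity_in_def)

lemma time_set_add:
  assumes "J = real ` {1..} \<or> J = {0<..}" "s \<in> J" "t \<in> J"
  shows "s + t \<in> J"
  using assms by (auto simp del: of_nat_add simp: of_nat_add[symmetric] intro!: imageI)

lemma time_set_pos:
  assumes "J = real ` {1..} \<or> J = {0<..}" "s \<in> J"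
  shows "0 < s"
  using assms by auto

lemma time_set_mult:
  assumes J: "J = real ` {1..} \<or> J = {0<..}" and c: "c \<in> J" and n: "1 \<le> n"
  shows "real n * c \<in> J"
  using n
proof (induction n rule: nat_induct_at_least)
  case base
  then show ?case using c by simp
next
  case (Suc n)
  then show ?case
    using time_set_add[OF J Suc.IH c] by (simp add: algebra_simps)
qed

lemma time_set_diff:
  assumes "J = real ` {1..} \<or> J = {0<..}" "s \<in> J" "t \<in> J" "s < t"
  shows "t - s \<in> J"
  using assms(1)
proof
  assume J: "J = real ` {1..}"
  then obtain m n where "s = real m" "t = real n"
    using assms by auto
  with assms(4) have "t - s = real (n - m)" "1 \<le> n - m"
    by auto
  then show ?thesis unfolding J by blast
qed (use assms in auto)

lemma filterlim_multiples_at_infinity_in: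
  assumes J: "J = real ` {1..} \<or> J = {0<..}" and c: "c \<in> J"
  shows "filterlim (\<lambda>n. real n * c) (at_infinity_in J) sequentially"
proof (rule filterlim_at_infinity_in)
  show "filterlim (\<lambda>n. real n * c) at_top sequentially"
    using time_set_pos[OF J c]
    by (intro filterlim_at_top_mult_tendsto_pos[OF tendsto_const] filterlim_real_sequentially)
  show "\<forall>\<^sub>F n in sequentially. real n * c \<in> J"
    using eventually_ge_at_top[of 1] by (rule eventually_mono) (rule time_set_mult[OF J c])
qed

lemma at_infinity_in_nontrivial:
  assumes J: "J = real ` {1..} \<or> J = {0<..}"
  shows "at_infinity_in J \<noteq> bot"
proof -
  have "1 \<in> J" using J by (auto intro!: image_eqI[of _ _ 1])
  from filterlim_multiples_at_infinity_in[OF J this] show ?thesis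
    unfolding filterlim_def by (auto simp: filtermap_bot_iff bot_unique)
qed

text \<open>
  Rounding \<open>t / c\<close> up and subtracting one, rather than rounding down, makes the remainder positive,
  so that it is again an admissible time.
\<close>

lemma time_set_split:
  assumes J: "J = real ` {1..} \<or> J = {0<..}" and c: "c \<in> J" and t: "t \<in> J"
  defines "n \<equiv> nat (\<lceil>t / c\<rceil> - 1)"
  shows "t - real n * c \<in> {0<..c} \<inter> J"
proof -
  have pos: "0 < c" "0 < t"
    using time_set_pos[OF J] c t by auto
  then have "0 < t / c" by simp
  then have "1 \<le> \<lceil>t / c\<rceil>" by simp
  then have n: "real n = of_int \<lceil>t / c\<rceil> - 1"
    by (simp add: n_def)
  have "real n < t / c" "t / c \<le> real n + 1"
    using ceiling_correct[of "t / c"] n by auto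
  then have le: "real n * c < t" "t \<le> real n * c + c"
    using pos by (auto simp: field_simps)
  have "t - real n * c \<in> J"
  proof (cases "n = 0")
    case False
    then show ?thesis
      using time_set_diff[OF J time_set_mult[OF J c] t le(1)] by simp
  qed (use t in simp)
  with le show ?thesis by auto
qed

section \<open>Limits of semigroups\<close>

text \<open>
  Let \<open>t\<close> tend to infinity in \<open>T (s + t) = T t o\<^sub>L T s = T s o\<^sub>L T t\<close>.
\<close>

lemma semigroup_limit_absorbs:
  fixes T :: "real \<Rightarrow> 'e::real_normed_vector \<Rightarrow>\<^sub>L 'e"
  assumes J: "J = real ` {1..} \<or> J = {0<..}"
    and T: "operator_semigroup J T"
    and lim: "\<And>x. ((\<lambda>t. blinfun_apply (T t) x) \<longlongrightarrow> blinfun_apply P x) (at_infinity_in J)"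
    and s: "s \<in> J"
  shows "P o\<^sub>L T s = P" "T s o\<^sub>L P = P"
proof -
  have "filterlim (\<lambda>t. s + t) (at_infinity_in J) (at_infinity_in J)"
  proof (rule filterlim_at_infinity_in)
    show "filterlim (\<lambda>t. s + t) at_top (at_infinity_in J)"
      using filterlim_tendsto_add_at_top[OF tendsto_const[of s] filterlim_ident]
      by (rule filterlim_mono[OF _ order.refl at_infinity_in_le])
    show "\<forall>\<^sub>F t in at_infinity_in J. s + t \<in> J"
      using eventually_at_infinity_in by (rule eventually_mono) (rule time_set_add[OF J s])
  qed
  then have shift: "((\<lambda>t. blinfun_apply (T (s + t)) x) \<longlongrightarrow> blinfun_apply P x) (at_infinity_in J)"
    for x
    using filterlim_compose[OF lim] by blast
  note unique = tendsto_unique[OF at_infinity_in_nontrivial[OF J]]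
  show "P o\<^sub>L T s = P"
  proof (rule blinfun_eqI)
    fix x
    have "\<forall>\<^sub>F t in at_infinity_in J. blinfun_apply (T (s + t)) x = blinfun_apply (T t) (blinfun_apply (T s) x)"
      using eventually_at_infinity_in
      by (rule eventually_mono) (use T s in \<open>simp add: operator_semigroup_def add.commute[of s]\<close>)
    from tendsto_cong[OF this] shift[of x]
    have "((\<lambda>t. blinfun_apply (T t) (blinfun_apply (T s) x)) \<longlongrightarrow> blinfun_apply P x) (at_infinity_in J)"
      by simp
    from unique[OF lim this] show "blinfun_apply (P o\<^sub>L T s) x = blinfun_apply P x"
      by simp
  qed
  show "T s o\<^sub>L P = P"
  proof (rule blinfun_eqI)
    fix x
    have "\<forall>\<^sub>F t in at_infinity_in J. blinfun_apply (T (s + t)) x = blinfun_apply (T s) (blinfun_apply (T t) x)"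
      using eventually_at_infinity_in
      by (rule eventually_mono) (use T s in \<open>simp add: operator_semigroup_def\<close>)
    from tendsto_cong[OF this] shift[of x]
    have "((\<lambda>t. blinfun_apply (T s) (blinfun_apply (T t) x)) \<longlongrightarrow> blinfun_apply P x) (at_infinity_in J)"
      by simp
    from unique[OF blinfun.tendsto[OF tendsto_const lim] this]
    show "blinfun_apply (T s o\<^sub>L P) x = blinfun_apply P x"
      by simp
  qed
qed

lemma semigroup_limit_idempotent:
  fixes T :: "real \<Rightarrow> 'e::real_normed_vector \<Rightarrow>\<^sub>L 'e"
  assumes J: "J = real ` {1..} \<or> J = {0<..}"
    and T: "operator_semigroup J T"
    and lim: "\<And>x. ((\<lambda>t. blinfun_apply (T t) x) \<longlongrightarrow> blinfun_apply P x) (at_infinity_in J)"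
  shows "P o\<^sub>L P = P"
proof (rule blinfun_eqI)
  fix x
  have "\<forall>\<^sub>F t in at_infinity_in J. blinfun_apply (T t) (blinfun_apply P x) = blinfun_apply P x"
    using eventually_at_infinity_in
    by (rule eventually_mono) (metis semigroup_limit_absorbs(2)[OF J T lim] blinfun_apply_blinfun_compose)
  from tendsto_cong[OF this] have "((\<lambda>t. blinfun_apply (T t) (blinfun_apply P x)) \<longlongrightarrow> blinfun_apply P x) (at_infinity_in J)"
    by simp
  from tendsto_unique[OF at_infinity_in_nontrivial[OF J] lim this]
  show "blinfun_apply (P o\<^sub>L P) x = blinfun_apply P x"
    by simp
qed

lemma semigroup_norm_limit_from_multiples:
  fixes T :: "real \<Rightarrow> 'e::real_normed_vector \<Rightarrow>\<^sub>L 'e"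
  assumes J: "J = real ` {1..} \<or> J = {0<..}"
    and T: "operator_semigroup J T"
    and c: "c \<in> J" and bdd: "bdd_above ((\<lambda>t. norm (T t)) ` ({0<..c} \<inter> J))"
    and absorb: "\<And>s. s \<in> J \<Longrightarrow> P o\<^sub>L T s = P"
    and lim: "(\<lambda>n. T (real n * c)) \<longlonglongrightarrow> P"
  shows "(T \<longlongrightarrow> P) (at_infinity_in J)"
proof -
  obtain K where K: "\<And>r. r \<in> {0<..c} \<inter> J \<Longrightarrow> norm (T r) \<le> K"
    using bdd unfolding bdd_above_def by blast
  have c0: "0 < c" by (rule time_set_pos[OF J c])
  define n where "n t = nat (\<lceil>t / c\<rceil> - 1)" for t
  have "filterlim n sequentially at_top"
    unfolding n_def filterlim_at_top
  proof
    fix k :: nat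
    show "\<forall>\<^sub>F t in at_top. k \<le> nat (\<lceil>t / c\<rceil> - 1)"
      using eventually_ge_at_top[of "(real k + 1) * c"]
    proof (rule eventually_mono)
      fix t assume "(real k + 1) * c \<le> t"
      then have "real k + 1 \<le> t / c" using c0 by (simp add: field_simps)
      then have "int k + 1 \<le> \<lceil>t / c\<rceil>"
        using le_of_int_ceiling[of "t / c"] by linarith
      then show "k \<le> nat (\<lceil>t / c\<rceil> - 1)" by linarith
    qed
  qed
  then have n_lim: "filterlim n sequentially (at_infinity_in J)"
    by (rule filterlim_mono[OF _ order.refl at_infinity_in_le])
  have "\<forall>\<^sub>F t in at_infinity_in J. norm (T t - P) \<le> norm (T (real (n t) * c) - P) * K"
    using eventually_at_infinity_in n_lim[unfolded filterlim_at_top, rule_format, of 1]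
  proof eventually_elim
    case (elim t)
    define r where "r = t - real (n t) * c"
    have r: "r \<in> {0<..c} \<inter> J"
      unfolding r_def n_def by (rule time_set_split[OF J c elim(1)])
    have "T (real (n t) * c + r) = T (real (n t) * c) o\<^sub>L T r"
      using T r time_set_mult[OF J c elim(2)] by (simp add: operator_semigroup_def)
    then have "T t - P = (T (real (n t) * c) o\<^sub>L T r) - (P o\<^sub>L T r)"
      using absorb[of r] r by (simp add: r_def)
    also have "\<dots> = (T (real (n t) * c) - P) o\<^sub>L T r"
      by (rule blinfun_eqI) (simp add: blinfun.diff_left)
    finally have "norm (T t - P) \<le> norm (T (real (n t) * c) - P) * norm (T r)"
      using norm_blinfun_compose by metis
    also have "\<dots> \<le> norm (T (real (n t) * c) - P) * K"
      using K[OF r] by (intro mult_left_mono) auto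
    finally show ?case .
  qed
  moreover have "((\<lambda>t. norm (T (real (n t) * c) - P) * K) \<longlongrightarrow> 0) (at_infinity_in J)"
    using filterlim_compose[OF lim n_lim]
    by (intro tendsto_mult_left_zero tendsto_norm_zero) (simp add: LIM_zero)
  ultimately have "((\<lambda>t. T t - P) \<longlongrightarrow> 0) (at_infinity_in J)"
    by (rule Lim_null_comparison)
  then show ?thesis by (simp add: Lim_null[of T])
qed

lemma ultra_strong_imp_norm_convergent:
  fixes T :: "real \<Rightarrow> 'e::real_normed_vector \<Rightarrow>\<^sub>L 'e"
  assumes J: "J = real ` {1..} \<or> J = {0<..}"
    and T: "operator_semigroup J T"
    and bounded: "locally_bounded_at_0 J T"
    and U: "free_ultrafilter U"
    and strong: "ultra_strongly_convergent U (\<lambda>t. ultra_lift U (T t)) (ultra_lift U P) (at_infinity_in J)"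
  shows "(T \<longlongrightarrow> P) (at_infinity_in J)"
proof -
  obtain c where c: "c \<in> J" and bdd: "bdd_above ((\<lambda>t. norm (T t)) ` ({0<..c} \<inter> J))"
    using bounded by (auto simp: locally_bounded_at_0_def)
  note lim = ultra_strongly_convergent_pointwise[OF U strong]
  note absorb = semigroup_limit_absorbs[OF J T lim]
  note idem = semigroup_limit_idempotent[OF J T lim]
  define B where "B n = T (real n * c) - P" for n
  have "B (m + n) = B m o\<^sub>L B n" if "1 \<le> m" "1 \<le> n" for m n
  proof -
    let ?m = "real m * c" and ?n = "real n * c"
    have mn: "?m \<in> J" "?n \<in> J"
      using that time_set_mult[OF J c] by auto
    have "B (m + n) = (T ?m o\<^sub>L T ?n) - P"
      using T mn by (simp add: B_def operator_semigroup_def distrib_right)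
    \<comment> \<open>The three products with \<open>P\<close> all equal \<open>P\<close>, so that \<open>- P - P + P\<close> replaces \<open>- P\<close>.\<close>
    also have "\<dots> = (T ?m o\<^sub>L T ?n) - (T ?m o\<^sub>L P) - (P o\<^sub>L T ?n) + (P o\<^sub>L P)"
      using absorb[OF mn(1)] absorb[OF mn(2)] idem by simp
    also have "\<dots> = B m o\<^sub>L B n"
      by (rule blinfun_eqI)
        (simp add: B_def blinfun.diff_left blinfun.add_left blinfun.diff_right)
    finally show ?thesis .
  qed
  moreover have "(\<lambda>n. ultra_norm U (ultra_lift U (B n) X)) \<longlonglongrightarrow> 0" if "X \<in> ultra_power U" for X
    using filterlim_compose[OF
        strong[unfolded ultra_strongly_convergent_lift_iff, rule_format, OF that]
        filterlim_multiples_at_infinity_in[OF J c]]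
    by (simp add: B_def)
  ultimately have "B \<longlonglongrightarrow> 0"
    using ultra_strong_limit_zero_imp_norm[OF U] by blast
  then have "(\<lambda>n. T (real n * c)) \<longlonglongrightarrow> P"
    unfolding B_def by (rule LIM_zero_cancel)
  from semigroup_norm_limit_from_multiples[OF J T c bdd absorb(1) this] show ?thesis .
qed

theorem theorem2p5:
  fixes scale :: "'k::real_normed_field \<Rightarrow> 'e::banach \<Rightarrow> 'e"
    and J :: "real set"
    and T :: "real \<Rightarrow> 'e \<Rightarrow>\<^sub>L 'e"
    and P :: "'e \<Rightarrow>\<^sub>L 'e"
    and U :: "nat filter"
  assumes "normed_space_over scale"
    and "J = real ` {1..} \<or> J = {0<..}"
    and "\<And>t. t \<in> J \<Longrightarrow> Vector_Spaces.linear scale scale (blinfun_apply (T t))"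
    and "operator_semigroup J T"
    and "locally_bounded_at_0 J T"
    and "free_ultrafilter U"
    and "Vector_Spaces.linear scale scale (blinfun_apply P)"
  shows "((T \<longlongrightarrow> P) (at_infinity_in J)
           \<longleftrightarrow> ultra_norm_convergent U (\<lambda>t. ultra_lift U (T t)) (ultra_lift U P) (at_infinity_in J))
       \<and> (ultra_norm_convergent U (\<lambda>t. ultra_lift U (T t)) (ultra_lift U P) (at_infinity_in J)
           \<longleftrightarrow> ultra_strongly_convergent U (\<lambda>t. ultra_lift U (T t)) (ultra_lift U P) (at_infinity_in J))"
  using ultra_norm_convergent_lift_iff[OF assms(6)] ultra_strongly_convergent_liftI[OF assms(6)]
    ultra_strong_imp_norm_convergent[OF assms(2) assms(4) assms(5) assms(6)]
  by blast

end
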